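(* Let $G$ be a graph and let $\mathcal{P} = (A_1, \dots, A_k)$ be a monotone partition of $V(G)$ into cliques $A_1, \dots, A_k$. If $\mathcal{P}$ has the hev-property, then $G$ has clique-width at most $k+1$.
   Context: Graphs are finite and simple. Parts of a partition are allowed to be empty. For a vertex $v$ and a set $Y$ of vertices, $N_Y(v)$ is the set of neighbours of $v$ lying in $Y$. For disjoint sets $X, Y$ of vertices, $X$ is complete (resp. anticomplete) to $Y$ if all possible edges (resp. no edges) between $X$ and $Y$ are present; $X$ is uniform to $Y$ if it is complete or anticomplete to $Y$; a vertex $v$ is uniform to $Y$ if $\{v\}$ is. $X$ is monotone to $Y$ if for all $u,v \in X$, either $N_Y(u) \subseteq N_Y(v)$ or $N_Y(v) \subseteq N_Y(u)$. A partition $\mathcal{P} = (A_1,\dots,A_k)$ of $V(G)$ is monotone if for every $i$, $A_i$ is monotone to $V(G)\setminus A_i$. In a monotone partition, a vertex $v\in A_i$ is maximal (resp. minimal) if $N_{V(G)\setminus A_i}(v)$ is inclusion-wise maximal (resp. minimal) among the sets $N_{V(G)\setminus A_i}(u)$, $u \in A_i$; it is extreme if it is maximal or minimal. A monotone partition $\mathcal{P}$ has the extreme vertex property if there exist $i\in\{1,\dots,k\}$ and an extreme vertex $v$ of $A_i$ such that $v$ is uniform to $A_j$ for all $j\in\{1,\dots,k\}\setminus\{i\}$. $\mathcal{P}$ has the hereditary extreme vertex property (hev-property) if for every non-empty set $X\subseteq V(G)$, the partition $\mathcal{P}[X] = (A_1\cap X,\dots,A_k\cap X)$ of $X$ has the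 extreme vertex property in the induced subgraph $G[X]$. The clique-width of a graph $G$ is the minimum number of labels needed to build $G$ by the following four operations: (1) create a vertex with label $i$; (2) take the disjoint union of two previously constructed labelled graphs; (3) for some $i \neq j$, join by an edge every vertex with label $i$ to every vertex with label $j$; (4) relabel all vertices with label $i$ by label $j$. *)

theory Defs
  imports "Graph_Theory.Digraph_Component" "HOL-Library.Disjoint_Sets"
begin

text \<open>
  A finite simple graph is a \<open>graph\<close> of the library: a finite, symmetric, loopless digraph without
  parallel arcs. Adjacency of \<open>u\<close> and \<open>v\<close> is \<open>u \<rightarrow>\<^bsub>G\<^esub> v\<close>, and \<open>G \<restriction> X\<close> is the induced subgraph.
\<close>

definition nbrs_in :: "('a, 'b) pre_digraph \<Rightarrow> 'a set \<Rightarrow> 'a \<Rightarrow> 'a set" where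
  "nbrs_in G Y v = {w \<in> Y. v \<rightarrow>\<^bsub>G\<^esub> w}"

definition complete_to :: "('a, 'b) pre_digraph \<Rightarrow> 'a set \<Rightarrow> 'a set \<Rightarrow> bool" where
  "complete_to G X Y \<longleftrightarrow> (\<forall>x\<in>X. \<forall>y\<in>Y. x \<rightarrow>\<^bsub>G\<^esub> y)"

definition anticomplete_to :: "('a, 'b) pre_digraph \<Rightarrow> 'a set \<Rightarrow> 'a set \<Rightarrow> bool" where
  "anticomplete_to G X Y \<longleftrightarrow> (\<forall>x\<in>X. \<forall>y\<in>Y. \<not> x \<rightarrow>\<^bsub>G\<^esub> y)"

definition uniform_to :: "('a, 'b) pre_digraph \<Rightarrow> 'a set \<Rightarrow> 'a set \<Rightarrow> bool" where
  "uniform_to G X Y \<longleftrightarrow> complete_to G X Y \<or> anticomplete_to G X Y"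

definition monotone_to :: "('a, 'b) pre_digraph \<Rightarrow> 'a set \<Rightarrow> 'a set \<Rightarrow> bool" where
  "monotone_to G X Y \<longleftrightarrow>
     (\<forall>u\<in>X. \<forall>v\<in>X. nbrs_in G Y u \<subseteq> nbrs_in G Y v \<or> nbrs_in G Y v \<subseteq> nbrs_in G Y u)"

definition clique :: "('a, 'b) pre_digraph \<Rightarrow> 'a set \<Rightarrow> bool" where
  "clique G C \<longleftrightarrow> C \<subseteq> verts G \<and> (\<forall>u\<in>C. \<forall>v\<in>C. u \<noteq> v \<longrightarrow> u \<rightarrow>\<^bsub>G\<^esub> v)"

text \<open>
  A partition \<open>(A\<^sub>1, \<dots>, A\<^sub>k)\<close> is given by \<open>k\<close> and a family \<open>A\<close>, of which only the values on
  \<open>{1..k}\<close> matter. Parts may be empty.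
\<close>

definition is_partition :: "nat \<Rightarrow> (nat \<Rightarrow> 'a set) \<Rightarrow> 'a set \<Rightarrow> bool" where
  "is_partition k A V \<longleftrightarrow> (\<Union>i\<in>{1..k}. A i) = V \<and> disjoint_family_on A {1..k}"

definition monotone_partition :: "('a, 'b) pre_digraph \<Rightarrow> nat \<Rightarrow> (nat \<Rightarrow> 'a set) \<Rightarrow> bool" where
  "monotone_partition G k A \<longleftrightarrow>
     is_partition k A (verts G) \<and> (\<forall>i\<in>{1..k}. monotone_to G (A i) (verts G - A i))"

definition maximal_vertex :: "('a, 'b) pre_digraph \<Rightarrow> 'a set \<Rightarrow> 'a \<Rightarrow> bool" where
  "maximal_vertex G B v \<longleftrightarrow> v \<in> B \<and>
     (\<forall>u\<in>B. \<not> nbrs_in G (verts G - B) v \<subset> nbrs_in G (verts G - B) u)"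

definition minimal_vertex :: "('a, 'b) pre_digraph \<Rightarrow> 'a set \<Rightarrow> 'a \<Rightarrow> bool" where
  "minimal_vertex G B v \<longleftrightarrow> v \<in> B \<and>
     (\<forall>u\<in>B. \<not> nbrs_in G (verts G - B) u \<subset> nbrs_in G (verts G - B) v)"

definition extreme_vertex :: "('a, 'b) pre_digraph \<Rightarrow> 'a set \<Rightarrow> 'a \<Rightarrow> bool" where
  "extreme_vertex G B v \<longleftrightarrow> maximal_vertex G B v \<or> minimal_vertex G B v"

definition extreme_vertex_property :: "('a, 'b) pre_digraph \<Rightarrow> nat \<Rightarrow> (nat \<Rightarrow> 'a set) \<Rightarrow> bool" where
  "extreme_vertex_property G k A \<longleftrightarrow>
     (\<exists>i\<in>{1..k}. \<exists>v. extreme_vertex G (A i) v \<and> (\<forall>j\<in>{1..k} - {i}. uniform_to G {v} (A j)))"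

definition hev_property :: "('a, 'b) pre_digraph \<Rightarrow> nat \<Rightarrow> (nat \<Rightarrow> 'a set) \<Rightarrow> bool" where
  "hev_property G k A \<longleftrightarrow>
     (\<forall>X. X \<noteq> {} \<and> X \<subseteq> verts G \<longrightarrow> extreme_vertex_property (G \<restriction> X) k (\<lambda>i. A i \<inter> X))"

text \<open>
  \<open>cw_build m V E lab\<close>: the four operations with labels from \<open>{1..m}\<close> can produce the graph with
  vertex set \<open>V\<close> and symmetric adjacency relation \<open>E\<close> in which each \<open>v \<in> V\<close> has label \<open>lab v\<close>
  (the values of \<open>lab\<close> outside \<open>V\<close> are irrelevant). The vertices are built under their final names,
  so the disjoint union requires disjoint vertex sets.
\<close>

inductive cw_build :: "nat \<Rightarrow> 'a set \<Rightarrow> 'a rel \<Rightarrow> ('a \<Rightarrow> nat) \<Rightarrow> bool" for m :: nat where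
  create: "i \<in> {1..m} \<Longrightarrow> cw_build m {v} {} (\<lambda>_. i)"
| disjoint_union:
    "\<lbrakk>cw_build m V\<^sub>1 E\<^sub>1 lab\<^sub>1; cw_build m V\<^sub>2 E\<^sub>2 lab\<^sub>2; V\<^sub>1 \<inter> V\<^sub>2 = {}\<rbrakk>
     \<Longrightarrow> cw_build m (V\<^sub>1 \<union> V\<^sub>2) (E\<^sub>1 \<union> E\<^sub>2) (\<lambda>v. if v \<in> V\<^sub>1 then lab\<^sub>1 v else lab\<^sub>2 v)"
| join:
    "\<lbrakk>cw_build m V E lab; i \<in> {1..m}; j \<in> {1..m}; i \<noteq> j\<rbrakk>
     \<Longrightarrow> cw_build m V
          (E \<union> {(u, v). u \<in> V \<and> v \<in> V \<and> (lab u = i \<and> lab v = j \<or> lab u = j \<and> lab v = i)}) lab"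
| relabel:
    "\<lbrakk>cw_build m V E lab; i \<in> {1..m}; j \<in> {1..m}\<rbrakk>
     \<Longrightarrow> cw_build m V E (\<lambda>v. if lab v = i then j else lab v)"

text \<open>
  The operations never produce the empty graph; by convention it has clique-width 0. For every
  other graph the minimum exists, see \<open>cw_build_exists\<close> below.
\<close>

definition clique_width :: "('a, 'b) pre_digraph \<Rightarrow> nat" where
  "clique_width G =
     (if verts G = {} then 0 else (LEAST m. \<exists>lab. cw_build m (verts G) (arcs_ends G) lab))"

lemma cw_build_edgeless:
  assumes "finite V" "V \<noteq> {}" "f ` V \<subseteq> {1..m}"
  shows "\<exists>lab. cw_build m V {} lab \<and> (\<forall>v\<in>V. lab v = f v)"
  using assms
proof (induction V rule: finite_ne_induct)
  case (singleton x)
  then show ?case using cw_build.create[of "f x" m x] by auto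
next
  case (insert x F)
  then obtain lab where lab: "cw_build m F {} lab" "\<forall>v\<in>F. lab v = f v" by auto
  have "cw_build m ({x} \<union> F) ({} \<union> {}) (\<lambda>v. if v \<in> {x} then f x else lab v)"
    using insert by (intro cw_build.disjoint_union cw_build.create lab(1)) auto
  then show ?case using lab(2) by (intro exI[of _ "\<lambda>v. if v \<in> {x} then f x else lab v"]) auto
qed

lemma cw_build_edges:
  assumes "finite F" "cw_build m V {} lab" "inj_on lab V" "lab ` V \<subseteq> {1..m}"
    "F \<subseteq> V \<times> V" "irrefl F"
  shows "cw_build m V (F \<union> F\<inverse>) lab"
  using assms(1,5,6)
proof (induction F rule: finite_induct)
  case empty
  then show ?case using assms(2) by simp
next
  case (insert e F)
  obtain u v where e: "e = (u, v)" by (cases e)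
  have uv: "u \<in> V" "v \<in> V" "u \<noteq> v" using insert.prems by (auto simp: e irrefl_def)
  have "cw_build m V (F \<union> F\<inverse>) lab"
    using insert.prems by (intro insert.IH) (auto simp: irrefl_def)
  then have "cw_build m V ((F \<union> F\<inverse>) \<union> {(x, y). x \<in> V \<and> y \<in> V \<and>
      (lab x = lab u \<and> lab y = lab v \<or> lab x = lab v \<and> lab y = lab u)}) lab"
    using uv assms(3,4) by (intro cw_build.join) (auto dest: inj_onD)
  moreover have "{(x, y). x \<in> V \<and> y \<in> V \<and>
      (lab x = lab u \<and> lab y = lab v \<or> lab x = lab v \<and> lab y = lab u)} = {(u, v), (v, u)}"
    using uv assms(3) by (auto dest: inj_onD)
  moreover have "(F \<union> F\<inverse>) \<union> {(u, v), (v, u)} = insert e F \<union> (insert e F)\<inverse>"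
    by (auto simp: e)
  ultimately show ?case by simp
qed

lemma cw_build_exists:
  assumes "graph G" "verts G \<noteq> {}"
  shows "\<exists>m lab. cw_build m (verts G) (arcs_ends G) lab"
proof -
  interpret graph G by fact
  obtain f where f: "bij_betw f (verts G) {1..card (verts G)}"
    using finite_same_card_bij[of "verts G" "{1..card (verts G)}"] by auto
  then obtain lab where lab: "cw_build (card (verts G)) (verts G) {} lab"
      "\<forall>v\<in>verts G. lab v = f v"
    using cw_build_edgeless[of "verts G" f "card (verts G)"] assms(2) finite_verts
    unfolding bij_betw_def by blast
  have "inj_on lab (verts G)" "lab ` verts G \<subseteq> {1..card (verts G)}"
    using f lab(2) unfolding bij_betw_def inj_on_def by (metis, metis equalityD1 image_cong)
  then have "cw_build (card (verts G)) (verts G) (arcs_ends G \<union> (arcs_ends G)\<inverse>) lab"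
    by (intro cw_build_edges lab(1))
      (auto simp: arcs_ends_conv irrefl_def dest: no_loops)
  moreover have "arcs_ends G \<union> (arcs_ends G)\<inverse> = arcs_ends G"
    using sym_arcs by (auto simp: symmetric_def dest: symD)
  ultimately show ?thesis by auto
qed

end

theory Submission
  imports Defs
begin

text \<open>
  Every \<open>G \<restriction> X\<close> can be built so that each vertex ends up with the index of its part as its label,
  by induction on \<open>card X\<close>. The hev-property yields a vertex \<open>x\<close> in some part \<open>A i\<close> that is uniform
  to all the other parts. As \<open>A i\<close> is a clique, the neighbourhood of \<open>x\<close> in \<open>X - {x}\<close> is a union of
  label classes, so \<open>x\<close> can be added with the spare label \<open>k + 1\<close>, joined to these classes, and then
  relabelled to \<open>i\<close>.
\<close>

text \<open>A join leaves the labelling unchanged, so one join per element of \<open>J\<close>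
  accumulates all these edges. The hypothesis \<open>i \<notin> J\<close> supplies the distinct
  labels that each join requires.\<close>

lemma cw_build_joins:
  assumes "cw_build m V E lab" "i \<in> {1..m}" "finite J" "J \<subseteq> {1..m}" "i \<notin> J"
  shows "cw_build m V (E \<union> {(u, v). u \<in> V \<and> v \<in> V \<and>
           (lab u = i \<and> lab v \<in> J \<or> lab u \<in> J \<and> lab v = i)}) lab"
  using assms(3-5)
proof (induction J rule: finite_induct)
  case empty
  then show ?case using assms(1) by simp
next
  case (insert j J)
  let ?E = "\<lambda>J. E \<union> {(u, v). u \<in> V \<and> v \<in> V \<and>
    (lab u = i \<and> lab v \<in> J \<or> lab u \<in> J \<and> lab v = i)}"
  have "cw_build m V (?E J \<union> {(u, v). u \<in> V \<and> v \<in> V \<and>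
      (lab u = i \<and> lab v = j \<or> lab u = j \<and> lab v = i)}) lab"
    using insert assms(2) by (intro cw_build.join) auto
  also have "?E J \<union> {(u, v). u \<in> V \<and> v \<in> V \<and>
      (lab u = i \<and> lab v = j \<or> lab u = j \<and> lab v = i)} = ?E (insert j J)"
    by auto
  finally show ?case .
qed

text \<open>The labels on \<open>V\<close> are at most \<open>k\<close>, so after the union
  \<open>x\<close> alone carries \<open>Suc k\<close>. Joining this label to those in
  \<open>J\<close> therefore creates only edges at \<open>x\<close>.\<close>

lemma cw_build_add_vertex:
  assumes "cw_build (Suc k) V E lab" "x \<notin> V" "lab ` V \<subseteq> {1..k}" "i \<in> {1..k}" "J \<subseteq> {1..k}"
  defines "N \<equiv> {v \<in> V. lab v \<in> J}"
  shows "\<exists>lab'. cw_build (Suc k) (insert x V) (E \<union> {x} \<times> N \<union> N \<times> {x}) lab' \<and>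
           lab' x = i \<and> (\<forall>v\<in>V. lab' v = lab v)"
proof -
  let ?lab = "\<lambda>v. if v \<in> {x} then Suc k else lab v"
  have lab_le: "lab v \<in> {1..k}" if "v \<in> V" for v
    using assms(3) that by blast
  have "cw_build (Suc k) ({x} \<union> V) ({} \<union> E) ?lab"
    using assms(1,2) by (intro cw_build.disjoint_union cw_build.create) auto
  then have "cw_build (Suc k) ({x} \<union> V) (({} \<union> E) \<union> {(u, v). u \<in> {x} \<union> V \<and> v \<in> {x} \<union> V \<and>
      (?lab u = Suc k \<and> ?lab v \<in> J \<or> ?lab u \<in> J \<and> ?lab v = Suc k)}) ?lab"
    using assms(5) finite_subset[OF assms(5)] by (intro cw_build_joins) auto
  also have "{(u, v). u \<in> {x} \<union> V \<and> v \<in> {x} \<union> V \<and>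
      (?lab u = Suc k \<and> ?lab v \<in> J \<or> ?lab u \<in> J \<and> ?lab v = Suc k)} = {x} \<times> N \<union> N \<times> {x}"
    using assms(2,5) lab_le unfolding N_def by (fastforce split: if_splits)
  finally have "cw_build (Suc k) (insert x V) (E \<union> {x} \<times> N \<union> N \<times> {x}) ?lab"
    by (simp add: Un_assoc)
  \<comment> \<open>Relabelling \<open>Suc k\<close> to \<open>i\<close> changes only the label of
    \<open>x\<close> and frees the spare label for the next vertex.\<close>
  then have "cw_build (Suc k) (insert x V) (E \<union> {x} \<times> N \<union> N \<times> {x})
      (\<lambda>v. if ?lab v = Suc k then i else ?lab v)"
    using assms(4) by (intro cw_build.relabel) auto
  then show ?thesis
    using assms(2) lab_le by (intro exI conjI) (assumption, auto dest: lab_le)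
qed

lemma dominates_induce_subgraph_iff:
  "u \<rightarrow>\<^bsub>G \<restriction> X\<^esub> v \<longleftrightarrow> u \<in> X \<and> v \<in> X \<and> u \<rightarrow>\<^bsub>G\<^esub> v"
  by (auto simp: arcs_ends_conv arc_to_ends_def)

text \<open>The condition on \<open>lab\<close> is the invariant of the induction: labels at most
  \<open>k\<close> keep \<open>Suc k\<close> spare, and each label class lies inside a single
  part.\<close>

lemma cw_build_induce_subgraph:
  assumes "graph G" "is_partition k A (verts G)" "\<And>i. i \<in> {1..k} \<Longrightarrow> clique G (A i)"
    and "hev_property G k A" "X \<noteq> {}" "X \<subseteq> verts G"
  shows "\<exists>lab. cw_build (Suc k) X (arcs_ends (G \<restriction> X)) lab \<and> (\<forall>v\<in>X. lab v \<in> {1..k} \<and> v \<in> A (lab v))"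
proof -
  interpret graph G by fact
  have "finite X" using assms(6) finite_verts finite_subset by blast
  then show ?thesis using assms(5,6)
  proof (induction X rule: finite_psubset_induct)
    case (psubset X)
    from assms(4) psubset.prems have "extreme_vertex_property (G \<restriction> X) k (\<lambda>i. A i \<inter> X)"
      unfolding hev_property_def by blast
    then obtain i x where i: "i \<in> {1..k}" and x: "x \<in> A i" "x \<in> X"
      and uni: "\<And>j. j \<in> {1..k} \<Longrightarrow> j \<noteq> i \<Longrightarrow> uniform_to (G \<restriction> X) {x} (A j \<inter> X)"
      unfolding extreme_vertex_property_def extreme_vertex_def maximal_vertex_def minimal_vertex_def
      by blast
    have no_loop: "\<not> v \<rightarrow>\<^bsub>G\<^esub> v" for v
      using adj_not_same by blast
    show ?case
    proof (cases "X = {x}")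
      \<comment> \<open>Treated separately because no operation yields the empty graph, so the
        induction hypothesis does not cover \<open>X - {x}\<close> here.\<close>
      case True
      then have "arcs_ends (G \<restriction> X) = {}"
        using no_loop dominates_induce_subgraph_iff[where G = G and X = X] by auto
      then show ?thesis
        using True i x cw_build.create[of i "Suc k" x] by (intro exI[of _ "\<lambda>_. i"]) auto
    next
      case False
      let ?X = "X - {x}"
      from False x psubset obtain lab
        where lab: "cw_build (Suc k) ?X (arcs_ends (G \<restriction> ?X)) lab"
          and lab_in: "\<And>v. v \<in> ?X \<Longrightarrow> lab v \<in> {1..k}" "\<And>v. v \<in> ?X \<Longrightarrow> v \<in> A (lab v)"
        using psubset.IH[of ?X] by blast
      \<comment> \<open>The sets are cut down to \<open>?X\<close> because \<open>x\<close> lies in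
        \<open>A i\<close> and is not adjacent to itself. Labels of parts that miss
        \<open>?X\<close> belong to \<open>J\<close> vacuously, which adds no edge.\<close>
      define J where "J = {j \<in> {1..k}. \<forall>w \<in> A j \<inter> ?X. x \<rightarrow>\<^bsub>G\<^esub> w}"
      have J: "lab v \<in> J \<longleftrightarrow> x \<rightarrow>\<^bsub>G\<^esub> v" if v: "v \<in> ?X" for v
      proof (cases "lab v = i")
        case True
        \<comment> \<open>Both sides hold, because \<open>A i\<close> is a clique containing
          \<open>x\<close>.\<close>
        then show ?thesis
          using assms(3)[OF i] i x v lab_in[OF v] unfolding J_def clique_def by auto
      next
        case False
        \<comment> \<open>By uniformity, the adjacency of \<open>x\<close> to the single vertex
          \<open>v\<close> decides its adjacency to the whole part of \<open>v\<close> within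
          \<open>X\<close>.\<close>
        then show ?thesis
          using uni[OF lab_in(1)[OF v] False] v lab_in[OF v] x
          unfolding J_def uniform_to_def complete_to_def anticomplete_to_def
            dominates_induce_subgraph_iff by blast
      qed
      let ?N = "{v \<in> ?X. lab v \<in> J}"
      obtain lab' where lab': "cw_build (Suc k) (insert x ?X)
            (arcs_ends (G \<restriction> ?X) \<union> {x} \<times> ?N \<union> ?N \<times> {x}) lab'"
          "lab' x = i" "\<forall>v\<in>?X. lab' v = lab v"
        using cw_build_add_vertex[OF lab, of x i J] lab_in(1) i unfolding J_def by blast
      \<comment> \<open>An edge within \<open>X\<close> either avoids \<open>x\<close> or joins it
        to a vertex of \<open>?N\<close>, by \<open>J\<close>.\<close>
      have "arcs_ends (G \<restriction> ?X) \<union> {x} \<times> ?N \<union> ?N \<times> {x} = arcs_ends (G \<restriction> X)"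
      proof (intro equalityI subrelI)
        fix u v assume "(u, v) \<in> arcs_ends (G \<restriction> ?X) \<union> {x} \<times> ?N \<union> ?N \<times> {x}"
        then show "u \<rightarrow>\<^bsub>G \<restriction> X\<^esub> v"
          using J x unfolding dominates_induce_subgraph_iff Un_iff
          by (auto intro: graph_symmetric simp: dominates_induce_subgraph_iff)
      next
        fix u v assume "u \<rightarrow>\<^bsub>G \<restriction> X\<^esub> v"
        then show "(u, v) \<in> arcs_ends (G \<restriction> ?X) \<union> {x} \<times> ?N \<union> ?N \<times> {x}"
          using J x no_loop graph_symmetric unfolding dominates_induce_subgraph_iff Un_iff
          by (cases "u = x"; cases "v = x") auto
      qed
      moreover have "insert x ?X = X" using x by blast
      moreover have "lab' v \<in> {1..k} \<and> v \<in> A (lab' v)" if "v \<in> X" for v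
        using lab'(2,3) lab_in[of v] i x that by (cases "v = x") auto
      ultimately show ?thesis
        using lab'(1) by (intro exI[of _ lab']) simp
    qed
  qed
qed

theorem theorem2p6:
  fixes G :: "('a, 'b) pre_digraph" and k :: nat and A :: "nat \<Rightarrow> 'a set"
  assumes "graph G"
    and "monotone_partition G k A"
    and "\<And>i. i \<in> {1..k} \<Longrightarrow> clique G (A i)"
    and "hev_property G k A"
  shows "clique_width G \<le> k + 1"
proof (cases "verts G = {}")
  case True
  then show ?thesis by (simp add: clique_width_def)
next
  case False
  interpret graph G by fact
  \<comment> \<open>Clique-width depends only on the vertex set and the adjacency relation, so
    agreement of \<open>arcs_ends\<close> is enough to pass from the induced subgraph to
    \<open>G\<close>.\<close>
  have "arcs_ends (G \<restriction> verts G) = arcs_ends G"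
    using dominates_induce_subgraph_iff[where G = G and X = "verts G"] adj_in_verts by auto
  with False assms obtain lab where "cw_build (k + 1) (verts G) (arcs_ends G) lab"
    using cw_build_induce_subgraph[of G k A "verts G"] by (auto simp: monotone_partition_def)
  then show ?thesis
    using False unfolding clique_width_def by (auto intro: Least_le)
qed

end
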